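(* $IV(0,1)=\left\{\frac{k}{k+1} : k\in\mathbb{Z},\ k\geq 1\right\}$.
   Context: For real numbers $a_1<a_2<\dots<a_r$, let $SEQ(a_1,\dots,a_r)$ be the set of all sequences $\{x_n\}_{n\geq 1}$ with $x_n\in\{a_1,\dots,a_r\}$ for all $n\geq 1$. For a sequence $\{x_n\}_{n\geq 1}$ put $\bar{x}_n=\frac{x_1+\dots+x_n}{n}$. Define $IV(a_1,\dots,a_r)$ to be the set of all real numbers $\Pi\in(a_1,a_r)$ (open interval) with the following property: whenever $\{x_n\}_{n\geq 1}\in SEQ(a_1,\dots,a_r)$ and $\bar{x}_k<\Pi<\bar{x}_l$ for some integers $1\leq k<l$, there exists an integer $s$ with $k<s<l$ such that $\bar{x}_s=\Pi$. *)

theory Defs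
  imports Complex_Main
begin

(* The parameters a_1 < ... < a_r are given as the list as = [a_1, ..., a_r]; the definitions
   are meant for nonempty, strictly increasing lists, so that hd as = a_1 and last as = a_r.
   Sequences are indexed from 1: the value x 0 is unconstrained and never used. *)

definition SEQ :: "real list \<Rightarrow> (nat \<Rightarrow> real) set" where
  "SEQ as = {x. \<forall>n\<ge>1. x n \<in> set as}"

definition seq_mean :: "(nat \<Rightarrow> real) \<Rightarrow> nat \<Rightarrow> real" where
  "seq_mean x n = (\<Sum>i=1..n. x i) / real n"

definition IV :: "real list \<Rightarrow> real set" where
  "IV as = {p \<in> {hd as<..<last as}.
     \<forall>x\<in>SEQ as. \<forall>k l. 1 \<le> k \<and> k < l \<and> seq_mean x k < p \<and> p < seq_mean x l
       \<longrightarrow> (\<exists>s. k < s \<and> s < l \<and> seq_mean x s = p)}"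

end

theory Submission
  imports Defs
begin

text \<open>
  Write $S_n = x_1 + \dots + x_n$. If $p = k/(k+1)$, the integer $(k+1) S_n - k n$ has the sign of
  $\bar x_n - p$ and increases by at most one per step, so it cannot change from negative to
  positive without vanishing. Otherwise $m/(m+1) < p < (m+1)/(m+2)$ for some $m \ge 0$, and the
  sequence $0, 1, 1, \dots$, whose means are $(n-1)/n$, jumps over $p$.
\<close>

text \<open>A negative integer is at most -1, so a step of at most +1 leads to at most 0. If 0 is
  avoided strictly between \<open>k\<close> and \<open>l\<close>, then \<open>E\<close> stays
  negative up to \<open>l - 1\<close> (possibly \<open>k\<close> itself), and the last step cannot
  make it positive.\<close>

lemma int_upcrossing_hits_zero:
  fixes E :: "nat \<Rightarrow> int"
  assumes step: "\<And>n. E (Suc n) \<le> E n + 1"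
    and "k < l" "E k < 0" "0 < E l"
  shows "\<exists>s. k < s \<and> s < l \<and> E s = 0"
proof (rule ccontr)
  assume no: "\<not> ?thesis"
  have "k \<le> n \<Longrightarrow> n < l \<Longrightarrow> E n < 0" for n
  proof (induction n rule: dec_induct)
    case base
    show ?case by fact
  next
    case (step n)
    then have "E (Suc n) \<noteq> 0" using no by auto
    with step assms(1)[of n] show ?case by simp
  qed
  moreover have "k \<le> l - 1" "l - 1 < l" using \<open>k < l\<close> by auto
  ultimately have "E (l - 1) < 0" by blast
  with step[of "l - 1"] \<open>k < l\<close> \<open>0 < E l\<close> show False by simp
qed

lemma ratio_in_IV:
  assumes "k \<ge> (1::int)"
  shows "real_of_int k / (real_of_int k + 1) \<in> IV [0, 1]"
proof -
  let ?p = "real_of_int k / (real_of_int k + 1)"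
  have "\<exists>s. a < s \<and> s < b \<and> seq_mean x s = ?p"
    if x: "x \<in> SEQ [0, 1]" and ab: "1 \<le> a" "a < b" and below: "seq_mean x a < ?p"
      and above: "?p < seq_mean x b"
    for x a b
  proof -
    \<comment> \<open>Counting the ones replaces the real sum, so that \<open>E\<close> is
      integer-valued by its type.\<close>
    define E :: "nat \<Rightarrow> int" where
      "E n = (k + 1) * (\<Sum>i=1..n. if x i = 1 then 1 else 0) - k * int n" for n
    have sum: "real_of_int (\<Sum>i=1..n. if x i = 1 then 1 else 0) = (\<Sum>i=1..n. x i)" for n
      unfolding of_int_sum using x by (intro sum.cong) (auto simp: SEQ_def)
    have E_mean: "real_of_int (E n) = (k + 1) * real n * (seq_mean x n - ?p)" if "n \<ge> 1" for n
    proof -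
      have "(\<Sum>i=1..n. x i) = real n * seq_mean x n"
        using that by (simp add: seq_mean_def)
      then show ?thesis
        unfolding E_def of_int_diff of_int_mult sum using assms by (simp add: right_diff_distrib)
    qed
    have pos: "0 < (real_of_int k + 1) * real n" if "n \<ge> 1" for n
      using that assms by simp
    have "real_of_int (E a) < 0"
      using E_mean[OF ab(1)] pos[OF ab(1)] below by (simp add: mult_pos_neg)
    moreover have "0 < real_of_int (E b)"
      using E_mean[of b] pos[of b] above ab by simp
    \<comment> \<open>A term 1 adds (k + 1) - k = 1, a term 0 adds -k < 0.\<close>
    moreover have "E (Suc n) \<le> E n + 1" for n
      using assms by (simp add: E_def algebra_simps)
    ultimately obtain s where s: "a < s" "s < b" "E s = 0"
      using int_upcrossing_hits_zero[of E a b] ab by auto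
    then have "seq_mean x s = ?p"
      using E_mean[of s] pos[of s] by auto
    with s show ?thesis by blast
  qed
  with assms show ?thesis by (simp add: IV_def)
qed

lemma IV_imp_ratio:
  assumes "p \<in> IV [0, 1]"
  obtains k :: int where "k \<ge> 1" "p = real_of_int k / (real_of_int k + 1)"
proof -
  from assms have p: "0 < p" "p < 1" by (auto simp: IV_def)
  \<comment> \<open>The map p / (1 - p) is the increasing inverse of t / (t + 1), so its floor
    locates \<open>p\<close> between consecutive ratios.\<close>
  define m where "m = nat \<lfloor>p / (1 - p)\<rfloor>"
  have m: "real m \<le> p / (1 - p)" "p / (1 - p) < real m + 1"
    using p by (auto simp: m_def)
  have le: "real m / (real m + 1) \<le> p" and less: "p < (real m + 1) / (real m + 2)"
    using m p by (simp_all add: field_simps)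
  define x :: "nat \<Rightarrow> real" where "x i = (if i = 1 then 0 else 1)" for i
  have x: "x \<in> SEQ [0, 1]" by (auto simp: SEQ_def x_def)
  have "(\<Sum>i=1..Suc n. x i) = real n" for n
    by (induction n) (simp_all add: x_def)
  then have mean: "seq_mean x (Suc n) = real n / (real n + 1)" for n
    by (simp add: seq_mean_def add.commute)
  have "p = real m / (real m + 1)"
  proof (rule ccontr)
    assume "p \<noteq> real m / (real m + 1)"
    then have "seq_mean x (Suc m) < p" "p < seq_mean x (Suc (Suc m))"
      using le less by (simp_all only: mean) (simp_all add: add.commute)
    \<comment> \<open>The two indices are consecutive, so no such \<open>s\<close> exists.\<close>
    with assms x have "\<exists>s. Suc m < s \<and> s < Suc (Suc m) \<and> seq_mean x s = p"
      by (auto simp: IV_def)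
    then show False by auto
  qed
  \<comment> \<open>The case m = 0 would give p = 0, outside the open interval.\<close>
  moreover from this p have "m \<ge> 1" by (cases m) auto
  ultimately show ?thesis using that[of "int m"] by simp
qed

theorem theorem1:
  shows "IV [0, 1] = {real_of_int k / (real_of_int k + 1) | k :: int. k \<ge> 1}"
  using ratio_in_IV by (auto elim: IV_imp_ratio)

end
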